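(* Let $(L,[\cdot , \cdot ],\alpha ,\beta )$ be a BiHom-Lie algebra over a field $\Bbbk$, $\lambda \in \Bbbk $ a fixed scalar and $R:L\rightarrow L$ a Rota-Baxter operator of weight $\lambda $ for $(L,[\cdot,\cdot])$ satisfying $R\circ \alpha =\alpha \circ R$ and $R\circ \beta =\beta \circ R$. Define a new multiplication on $L$ by $$\{x,y\}=[R(x),y]+[x,R(y)]+\lambda [x,y],\quad \forall\, x,y\in L.$$ Then $(L,\{\cdot , \cdot \},\alpha ,\beta )$ is a BiHom-Lie algebra.
   Context: All linear spaces and (bi)linear maps are over a base field $\Bbbk$. A BiHom-Lie algebra $(L,[\cdot,\cdot],\alpha,\beta)$ is a linear space $L$ with linear maps $\alpha,\beta:L\to L$ and a bilinear map $[\cdot,\cdot]:L\times L\to L$ such that, for all $x,y,z\in L$: $\alpha\circ\beta=\beta\circ\alpha$; $\alpha([x,y])=[\alpha(x),\alpha(y)]$ and $\beta([x,y])=[\beta(x),\beta(y)]$; $[\beta(x),\alpha(y)]=-[\beta(y),\alpha(x)]$ (BiHom-skew-symmetry); and $$[\beta^2(x),[\beta(y),\alpha(z)]]+[\beta^2(y),[\beta(z),\alpha(x)]]+[\beta^2(z),[\beta(x),\alpha(y)]]=0$$ (BiHom-Jacobi condition). A Rota-Baxter operator of weight $\lambda$ for $(L,[\cdot,\cdot])$ is a linear map $R:L\to L$ with $[R(x),R(y)]=R([R(x),y]+[x,R(y)]+\lambda[x,y])$ for all $x,y\in L$. *)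

theory Defs
  imports Complex_Main
begin

text \<open>A linear space over a field is an instance of the library locale \<^locale>\<open>vector_space\<close>,
  whose scalar multiplication is an explicit parameter; the underlying set is the whole type.
  The constant \<open>Vector_Spaces.linear\<close> is linearity over an arbitrary field, whereas plain
  \<open>linear\<close> would mean real-linear.\<close>

locale bilinear_multiplication = vector_space scale
  for scale :: "'k::field \<Rightarrow> 'l::ab_group_add \<Rightarrow> 'l" +
  fixes bracket :: "'l \<Rightarrow> 'l \<Rightarrow> 'l"
  assumes linear_left: "\<And>y. Vector_Spaces.linear scale scale (\<lambda>x. bracket x y)"
    and linear_right: "\<And>x. Vector_Spaces.linear scale scale (\<lambda>y. bracket x y)"

locale bihom_lie_algebra = bilinear_multiplication scale bracket
  for scale :: "'k::field \<Rightarrow> 'l::ab_group_add \<Rightarrow> 'l"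
    and bracket :: "'l \<Rightarrow> 'l \<Rightarrow> 'l" +
  fixes \<alpha> \<beta> :: "'l \<Rightarrow> 'l"
  assumes linear_alpha: "Vector_Spaces.linear scale scale \<alpha>"
    and linear_beta: "Vector_Spaces.linear scale scale \<beta>"
    and commute: "\<alpha> \<circ> \<beta> = \<beta> \<circ> \<alpha>"
    and alpha_bracket: "\<And>x y. \<alpha> (bracket x y) = bracket (\<alpha> x) (\<alpha> y)"
    and beta_bracket: "\<And>x y. \<beta> (bracket x y) = bracket (\<beta> x) (\<beta> y)"
    and bihom_skew_symmetry: "\<And>x y. bracket (\<beta> x) (\<alpha> y) = - bracket (\<beta> y) (\<alpha> x)"
    and bihom_Jacobi: "\<And>x y z.
      bracket (\<beta> (\<beta> x)) (bracket (\<beta> y) (\<alpha> z))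
      + bracket (\<beta> (\<beta> y)) (bracket (\<beta> z) (\<alpha> x))
      + bracket (\<beta> (\<beta> z)) (bracket (\<beta> x) (\<alpha> y)) = 0"

locale rota_baxter_operator = bilinear_multiplication scale bracket
  for scale :: "'k::field \<Rightarrow> 'l::ab_group_add \<Rightarrow> 'l"
    and bracket :: "'l \<Rightarrow> 'l \<Rightarrow> 'l" +
  fixes weight :: 'k and R :: "'l \<Rightarrow> 'l"
  assumes linear_R: "Vector_Spaces.linear scale scale R"
    and rota_baxter: "\<And>x y. bracket (R x) (R y)
      = R (bracket (R x) y + bracket x (R y) + scale weight (bracket x y))"

end

theory Submission
  imports Defs
begin

text \<open>Write \<open>{x, y}\<close> for the deformed multiplication and \<open>\<lambda>\<close> for the weight.  The Rota-Baxter identity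
  says precisely that \<open>R\<close> sends \<open>{x, y}\<close> to \<open>[R x, R y]\<close>.  So in
  \<open>{u, {v, w}}\<close> the only term with \<open>R\<close> outside a bracket turns into \<open>[u, [R v, R w]]\<close>, and bilinearity then expands that expression into
  \<open>[R u, [R v, w]] + [R u, [v, R w]] + [u, [R v, R w]]
    + \<lambda> ([R u, [v, w]] + [u, [R v, w]] + [u, [v, R w]]) + \<lambda>\<^sup>2 [u, [v, w]]\<close>,
  which is \<open>[u, [v, w]]\<close> summed over all ways of applying \<open>R\<close> to some, but not all, of the three arguments,
  with one factor \<open>\<lambda>\<close> for each argument beyond the first that is left alone.  This pattern is symmetric in
  \<open>u\<close>, \<open>v\<close>, \<open>w\<close>, so the cyclic sum in the BiHom-Jacobi condition for \<open>{x, y}\<close> splits into seven cyclic sums for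
  the original bracket, each with arguments chosen among \<open>x\<close>, \<open>y\<close>, \<open>z\<close> and their images under \<open>R\<close>, and each
  of them vanishes.  Since \<open>R\<close> commutes with \<open>\<alpha>\<close> and \<open>\<beta>\<close>, the twisted arguments have the form that the
  original axioms require.  BiHom-skew-symmetry comes from the same idea in degree two, where
  skew-symmetry exchanges, up to sign, the two terms that contain \<open>R\<close>.\<close>

context bilinear_multiplication
begin

lemma bracket_add_left: "bracket (x + x') y = bracket x y + bracket x' y"
  and bracket_scale_left: "bracket (scale c x) y = scale c (bracket x y)"
  using linear_left[of y] by (simp_all add: Vector_Spaces.linear_iff)

lemma bracket_add_right: "bracket x (y + y') = bracket x y + bracket x y'"
  and bracket_scale_right: "bracket x (scale c y) = scale c (bracket x y)"
  using linear_right[of x] by (simp_all add: Vector_Spaces.linear_iff)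

lemmas bracket_bilinear =
  bracket_add_left bracket_scale_left bracket_add_right bracket_scale_right

end

context rota_baxter_operator
begin

definition deformed_bracket :: "'l \<Rightarrow> 'l \<Rightarrow> 'l"
  where "deformed_bracket x y = bracket (R x) y + bracket x (R y) + scale weight (bracket x y)"

lemma R_deformed_bracket: "R (deformed_bracket x y) = bracket (R x) (R y)"
  by (simp add: deformed_bracket_def rota_baxter)

lemma bilinear_multiplication_deformed_bracket:
  "bilinear_multiplication scale deformed_bracket"
proof -
  have R_add: "R (x + y) = R x + R y" and R_scale: "R (scale c x) = scale c (R x)" for x y c
    using linear_R by (simp_all add: Vector_Spaces.linear_iff)
  show ?thesis
    by unfold_locales
      (simp_all add: deformed_bracket_def R_add R_scale bracket_bilinear scale_right_distrib
        mult.commute algebra_simps)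
qed

text \<open>The term \<open>bracket u (bracket (R v) (R w))\<close> is where the Rota-Baxter identity enters; the others come from
  bilinearity alone.  Every placement of \<open>R\<close> on one or two arguments occurs exactly once, which is what
  allows the terms of a cyclic sum to be regrouped by placement.\<close>

lemma deformed_bracket_nested:
  "deformed_bracket u (deformed_bracket v w) =
     bracket (R u) (bracket (R v) w) + bracket (R u) (bracket v (R w)) + bracket u (bracket (R v) (R w))
     + scale weight (bracket (R u) (bracket v w) + bracket u (bracket (R v) w) + bracket u (bracket v (R w)))
     + scale weight (scale weight (bracket u (bracket v w)))"
proof -
  have "deformed_bracket u (deformed_bracket v w) =
      bracket (R u) (deformed_bracket v w) + bracket u (bracket (R v) (R w))
      + scale weight (bracket u (deformed_bracket v w))"
    by (simp add: deformed_bracket_def[of u] R_deformed_bracket)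
  then show ?thesis
    by (simp add: deformed_bracket_def bracket_bilinear scale_right_distrib algebra_simps)
qed

end

theorem proposition4p13:
  fixes scale :: "'k::field \<Rightarrow> 'l::ab_group_add \<Rightarrow> 'l"
    and bracket :: "'l \<Rightarrow> 'l \<Rightarrow> 'l"
    and \<alpha> \<beta> R :: "'l \<Rightarrow> 'l"
    and weight :: 'k
  assumes "bihom_lie_algebra scale bracket \<alpha> \<beta>"
    and "rota_baxter_operator scale bracket weight R"
    and "R \<circ> \<alpha> = \<alpha> \<circ> R"
    and "R \<circ> \<beta> = \<beta> \<circ> R"
  shows "bihom_lie_algebra scale
    (\<lambda>x y. bracket (R x) y + bracket x (R y) + scale weight (bracket x y)) \<alpha> \<beta>"
proof -
  interpret L: bihom_lie_algebra scale bracket \<alpha> \<beta> by fact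
  interpret RB: rota_baxter_operator scale bracket weight R by fact
  interpret D: bilinear_multiplication scale RB.deformed_bracket
    by (rule RB.bilinear_multiplication_deformed_bracket)
  have R_\<alpha>: "R (\<alpha> x) = \<alpha> (R x)" and R_\<beta>: "R (\<beta> x) = \<beta> (R x)" for x
    using assms(3,4) by (simp_all add: fun_eq_iff)
  have \<alpha>_linear: "\<alpha> (x + y) = \<alpha> x + \<alpha> y" "\<alpha> (scale c x) = scale c (\<alpha> x)"
    and \<beta>_linear: "\<beta> (x + y) = \<beta> x + \<beta> y" "\<beta> (scale c x) = scale c (\<beta> x)" for x y c
    using L.linear_alpha L.linear_beta by (simp_all add: Vector_Spaces.linear_iff)
  have "bihom_lie_algebra scale RB.deformed_bracket \<alpha> \<beta>"
  proof unfold_locales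
    show "\<alpha> \<circ> \<beta> = \<beta> \<circ> \<alpha>"
      by (rule L.commute)
    show "\<alpha> (RB.deformed_bracket x y) = RB.deformed_bracket (\<alpha> x) (\<alpha> y)" for x y
      by (simp add: RB.deformed_bracket_def \<alpha>_linear L.alpha_bracket R_\<alpha>)
    show "\<beta> (RB.deformed_bracket x y) = RB.deformed_bracket (\<beta> x) (\<beta> y)" for x y
      by (simp add: RB.deformed_bracket_def \<beta>_linear L.beta_bracket R_\<beta>)
    show "RB.deformed_bracket (\<beta> x) (\<alpha> y) = - RB.deformed_bracket (\<beta> y) (\<alpha> x)" for x y
    proof -
      have "RB.deformed_bracket (\<beta> x) (\<alpha> y) =
          bracket (\<beta> (R x)) (\<alpha> y) + bracket (\<beta> x) (\<alpha> (R y)) + scale weight (bracket (\<beta> x) (\<alpha> y))"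
        by (simp add: RB.deformed_bracket_def R_\<alpha> R_\<beta>)
      also have "\<dots> = - bracket (\<beta> y) (\<alpha> (R x)) - bracket (\<beta> (R y)) (\<alpha> x)
          - scale weight (bracket (\<beta> y) (\<alpha> x))"
        by (simp add: L.bihom_skew_symmetry[of "R x" y] L.bihom_skew_symmetry[of x "R y"]
            L.bihom_skew_symmetry[of x y] L.scale_minus_right)
      also have "\<dots> = - RB.deformed_bracket (\<beta> y) (\<alpha> x)"
        by (simp add: RB.deformed_bracket_def R_\<alpha> R_\<beta>)
      finally show ?thesis .
    qed
    show "RB.deformed_bracket (\<beta> (\<beta> x)) (RB.deformed_bracket (\<beta> y) (\<alpha> z))
        + RB.deformed_bracket (\<beta> (\<beta> y)) (RB.deformed_bracket (\<beta> z) (\<alpha> x))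
        + RB.deformed_bracket (\<beta> (\<beta> z)) (RB.deformed_bracket (\<beta> x) (\<alpha> y)) = 0" for x y z
    proof -
      define T where "T x y z = bracket (\<beta> (\<beta> x)) (bracket (\<beta> y) (\<alpha> z))" for x y z
      define J where "J x y z = T x y z + T y z x + T z x y" for x y z
      have J_zero: "J x y z = 0" for x y z
        unfolding J_def T_def by (rule L.bihom_Jacobi)
      have deformed_T: "RB.deformed_bracket (\<beta> (\<beta> x)) (RB.deformed_bracket (\<beta> y) (\<alpha> z)) =
          T (R x) (R y) z + T (R x) y (R z) + T x (R y) (R z)
          + scale weight (T (R x) y z + T x (R y) z + T x y (R z))
          + scale weight (scale weight (T x y z))" for x y z
        by (simp add: RB.deformed_bracket_nested R_\<alpha> R_\<beta> T_def)
      \<comment> \<open>Each placement of \<open>R\<close> on \<open>x\<close>, \<open>y\<close>, \<open>z\<close> picks one term from each of the three expansions;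
        together these are the cyclic sum for those modified arguments.\<close>
      have "RB.deformed_bracket (\<beta> (\<beta> x)) (RB.deformed_bracket (\<beta> y) (\<alpha> z))
          + RB.deformed_bracket (\<beta> (\<beta> y)) (RB.deformed_bracket (\<beta> z) (\<alpha> x))
          + RB.deformed_bracket (\<beta> (\<beta> z)) (RB.deformed_bracket (\<beta> x) (\<alpha> y)) =
          J (R x) (R y) z + J (R x) y (R z) + J x (R y) (R z)
          + scale weight (J (R x) y z + J x (R y) z + J x y (R z))
          + scale weight (scale weight (J x y z))"
        by (simp add: deformed_T J_def L.scale_right_distrib ac_simps)
      also have "\<dots> = 0"
        by (simp add: J_zero)
      finally show ?thesis .
    qed
  qed (simp_all add: \<alpha>_linear \<beta>_linear)
  then show ?thesis
    unfolding RB.deformed_bracket_def[abs_def] .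
qed

end
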